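(* Let $n,m$ be positive integers with $m\le n$, let $A\in\mathbb{R}^{n\times n}$ be symmetric positive semidefinite, $B\in\mathbb{R}^{n\times m}$, $b\in\mathbb{R}^n$, and let $T_0<T_1$ be real numbers. The controlled quadratic gradient flow $$\dot x(t)=-Ax(t)+Bu(t)-b,\qquad x(T_0)=x_0\in\mathbb{R}^n,\qquad u\in L^\infty((T_0,T_1);\mathbb{R}^m),$$ is controllable on $[T_0,T_1]$ if and only if $$\operatorname{span}\big\{(-A)^iBy \;:\; y\in\mathbb{R}^m,\ i=0,\dots,n-1\big\}=\mathbb{R}^n .$$
   Context: For $x_0\in\mathbb{R}^n$ and a control $u\in L^\infty((T_0,T_1);\mathbb{R}^m)$, a solution (trajectory) is an absolutely continuous $x:[T_0,T_1]\to\mathbb{R}^n$ with $x(T_0)=x_0$ satisfying the differential equation for almost every $t$. The system is controllable on $[T_0,T_1]$ if for every initial point $x_0\in\mathbb{R}^n$ and every target $x_1\in\mathbb{R}^n$ there exists a control $u\in L^\infty((T_0,T_1);\mathbb{R}^m)$ such that the corresponding trajectory with $x(T_0)=x_0$ satisfies $x(T_1)=x_1$. The uncontrolled part is the gradient flow of $f(x)=\tfrac12\langle x,Ax\rangle+\langle b,x\rangle+c$. *)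

theory Defs
  imports "HOL-Analysis.Analysis"
begin

definition pos_semidef :: "real ^ 'n ^ 'n \<Rightarrow> bool" where
  "pos_semidef A \<longleftrightarrow> (\<forall>v. 0 \<le> v \<bullet> (A *v v))"

(* The operation ^ on real ^ 'n ^ 'n is the entrywise power, hence a separate definition. *)
primrec matrix_pow :: "real ^ 'n ^ 'n \<Rightarrow> nat \<Rightarrow> real ^ 'n ^ 'n" where
  "matrix_pow A 0 = mat 1"
| "matrix_pow A (Suc k) = A ** matrix_pow A k"

(* The classical epsilon-delta notion for functions on [a, b]; the constant
   absolutely_continuous of the library concerns measures. *)
definition abs_continuous_on_interval ::
    "real \<Rightarrow> real \<Rightarrow> (real \<Rightarrow> 'a::real_normed_vector) \<Rightarrow> bool" where
  "abs_continuous_on_interval a b f \<longleftrightarrow>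
     (\<forall>\<epsilon>>0. \<exists>\<delta>>0. \<forall>(N::nat) s t.
        (\<forall>i<N. a \<le> s i \<and> s i \<le> t i \<and> t i \<le> b) \<longrightarrow>
        disjoint_family_on (\<lambda>i. {s i<..<t i}) {..<N} \<longrightarrow>
        (\<Sum>i<N. t i - s i) < \<delta> \<longrightarrow>
        (\<Sum>i<N. norm (f (t i) - f (s i))) < \<epsilon>)"

(* L^infinity ((T0, T1); R^m), by representatives; values outside (T0, T1) are irrelevant. *)
definition L_infinity :: "real \<Rightarrow> real \<Rightarrow> (real \<Rightarrow> real ^ 'm) set" where
  "L_infinity T0 T1 =
     {u \<in> borel_measurable (lebesgue_on {T0<..<T1}).
        \<exists>C. AE t in lebesgue_on {T0<..<T1}. norm (u t) \<le> C}"

(* The term - (A *v x t) - b is the negative gradient at x t of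
   f x = (1/2) <x, A x> + <b, x> + c, for symmetric A. *)
definition is_trajectory ::
    "real ^ 'n ^ 'n \<Rightarrow> real ^ 'm ^ 'n \<Rightarrow> real ^ 'n \<Rightarrow> real \<Rightarrow> real \<Rightarrow>
     (real \<Rightarrow> real ^ 'm) \<Rightarrow> real ^ 'n \<Rightarrow> (real \<Rightarrow> real ^ 'n) \<Rightarrow> bool" where
  "is_trajectory A B b T0 T1 u x0 x \<longleftrightarrow>
     abs_continuous_on_interval T0 T1 x \<and>
     x T0 = x0 \<and>
     (AE t in lebesgue_on {T0<..<T1}.
        (x has_vector_derivative (- (A *v x t) + B *v u t - b)) (at t))"

definition controllable ::
    "real ^ 'n ^ 'n \<Rightarrow> real ^ 'm ^ 'n \<Rightarrow> real ^ 'n \<Rightarrow> real \<Rightarrow> real \<Rightarrow> bool" where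
  "controllable A B b T0 T1 \<longleftrightarrow>
     (\<forall>x0 x1. \<exists>u\<in>L_infinity T0 T1. \<exists>x. is_trajectory A B b T0 T1 u x0 x \<and> x T1 = x1)"

end

theory Submission
  imports Defs
begin

text \<open>
  If the Krylov vectors span, controls are found by differential flatness. For $v = By$ with
  $f^d v = \sum_{i<d} a_i f^i v$ (where $f = -A$) and any polynomial $\varphi$, the curve
  $\sum_{i<d} p_i f^i v$ with $p_{d-1} = \varphi$ and $p_{i-1} = p_i' - a_i \varphi$ is a trajectory
  of $\dot z = f z + B u$, the control being $u = (p_0' - a_0 \varphi)\, y$. Choosing
  $\varphi = (X - s)^j (X - t)^d$ gives a trajectory which vanishes at $t$ and whose value at $s$ is a
  nonzero multiple of $f^{d-1-j} v$ plus lower Krylov vectors; superposition then connects any two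
  points.

  Conversely, if the span is proper, $A$ has an eigenvector $w$ orthogonal to it. For two trajectories
  $x, y$ from the same point, $z = \langle w, x - y\rangle$ satisfies $\dot z = \mu z$ almost
  everywhere with $\mu \le 0$, so the absolutely continuous function $z^2$ cannot increase from its
  initial value $0$ and the $w$-component of the endpoint is independent of the control.
\<close>

section \<open>Linear dependence among Krylov iterates\<close>

text \<open>Induction on \<open>d\<close> splits off one generator at a time, so repeated values of
  \<open>g\<close> cause no trouble and the coefficients stay indexed by positions.\<close>

lemma span_image_lessThanE:
  fixes g :: "nat \<Rightarrow> 'a::real_vector"
  assumes "x \<in> span (g ` {..<d})"
  obtains a where "x = (\<Sum>i<d. a i *\<^sub>R g i)"
  using assms
proof (induction d arbitrary: x thesis)
  case 0
  then show ?case by simp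
next
  case (Suc d)
  from Suc.prems(2) obtain k where "x - k *\<^sub>R g d \<in> span (g ` {..<d})"
    by (auto simp: lessThan_Suc span_breakdown_eq)
  then obtain a where "x - k *\<^sub>R g d = (\<Sum>i<d. a i *\<^sub>R g i)"
    using Suc.IH by blast
  then have "x = (\<Sum>i<Suc d. (a(d := k)) i *\<^sub>R g i)"
    by (simp add: algebra_simps)
  then show ?case by (rule Suc.prems(1))
qed

text \<open>If no iterate lay in the span of its predecessors, each new one would raise the
  dimension by one, finally beyond \<open>DIM('a)\<close>. The case \<open>d = 0\<close> means
  \<open>v = 0\<close>. The bound on \<open>d\<close> later lets orthogonality to the first n
  iterates extend to all of them.\<close>

lemma krylov_dependence:
  fixes f :: "'a::euclidean_space \<Rightarrow> 'a"
  obtains d a where "d \<le> DIM('a)" "(f ^^ d) v = (\<Sum>i<d. a i *\<^sub>R (f ^^ i) v)"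
proof -
  have "\<exists>d\<le>DIM('a). (f ^^ d) v \<in> span ((\<lambda>i. (f ^^ i) v) ` {..<d})"
  proof (rule ccontr)
    assume indep: "\<not> ?thesis"
    have "dim ((\<lambda>i. (f ^^ i) v) ` {..<k}) = k" if "k \<le> Suc DIM('a)" for k
      using that
    proof (induction k)
      case (Suc k)
      then have "(f ^^ k) v \<notin> span ((\<lambda>i. (f ^^ i) v) ` {..<k})"
        using indep by auto
      then show ?case
        using Suc by (simp add: lessThan_Suc dim_insert)
    qed simp
    then have "dim ((\<lambda>i. (f ^^ i) v) ` {..<Suc DIM('a)}) = Suc DIM('a)"
      by blast
    then show False
      using dim_subset_UNIV[of "(\<lambda>i. (f ^^ i) v) ` {..<Suc DIM('a)}"] by simp
  qed
  then show thesis
    using that span_image_lessThanE by metis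
qed

lemma linear_funpow_sum:
  fixes f :: "'a::real_vector \<Rightarrow> 'a"
  assumes "linear f"
  shows "(f ^^ k) (\<Sum>i\<in>I. a i *\<^sub>R x i) = (\<Sum>i\<in>I. a i *\<^sub>R (f ^^ k) (x i))"
  using assms by (induction k) (simp_all add: linear_sum linear_cmul)

text \<open>Applying \<open>f ^^ (k - d)\<close> to the dependence expresses
  \<open>(f ^^ k) v\<close> through strictly earlier iterates. This does the work of the
  Cayley-Hamilton theorem, one vector at a time.\<close>

lemma krylov_subset:
  fixes f :: "'a::real_vector \<Rightarrow> 'a"
  assumes f: "linear f" and dep: "(f ^^ d) v = (\<Sum>i<d. a i *\<^sub>R (f ^^ i) v)"
    and V: "subspace V" and low: "\<And>i. i < d \<Longrightarrow> (f ^^ i) v \<in> V"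
  shows "(f ^^ k) v \<in> V"
proof (induction k rule: less_induct)
  case (less k)
  show ?case
  proof (cases "k < d")
    case False
    then have "(f ^^ k) v = (f ^^ (k - d)) ((f ^^ d) v)"
      by (metis add_diff_inverse_nat add.commute comp_apply funpow_add)
    also have "\<dots> = (\<Sum>i<d. a i *\<^sub>R (f ^^ (k - d + i)) v)"
      by (simp add: dep linear_funpow_sum[OF f] funpow_add)
    also have "\<dots> \<in> V"
      using False less by (intro subspace_sum V subspace_scale) auto
    finally show ?thesis .
  qed (rule low)
qed

section \<open>Polynomial trajectories from differential flatness\<close>

text \<open>
  With $c_k = a_{d-1-k}$, the $k$-th polynomial is the coefficient of $f^{d-1-k} v$ in the trajectory,
  and the $d$-th is the control.
\<close>
primrec flat_output :: "real poly \<Rightarrow> (nat \<Rightarrow> real) \<Rightarrow> nat \<Rightarrow> real poly" where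
  "flat_output \<phi> c 0 = \<phi>"
| "flat_output \<phi> c (Suc k) = pderiv (flat_output \<phi> c k) - smult (c k) \<phi>"

text \<open>Differentiation lowers the order of the zero at \<open>s\<close> by exactly one, while
  the subtracted multiple of the initial polynomial still has order at least \<open>j\<close>, too
  high to disturb the leading coefficient. For \<open>k = j\<close> the value at \<open>s\<close> is
  therefore nonzero.\<close>

lemma flat_output_order:
  fixes s :: real
  assumes "poly q s \<noteq> 0" "k \<le> j"
  shows "\<exists>r. flat_output ([:-s, 1:] ^ j * q) c k = [:-s, 1:] ^ (j - k) * r \<and> poly r s \<noteq> 0"
  using assms(2)
proof (induction k)
  case 0
  then show ?case using assms(1) by auto
next
  case (Suc k)
  let ?X = "[:-s, 1:]"
  obtain r where r: "flat_output (?X ^ j * q) c k = ?X ^ (j - k) * r" "poly r s \<noteq> 0"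
    using Suc by auto
  obtain m where m: "j = Suc (k + m)"
    using Suc.prems by (metis add_Suc less_iff_Suc_add Suc_le_lessD)
  \<comment> \<open>As \<open>j - k = Suc m\<close>, the factor \<open>?X ^ m\<close> splits off. At
    \<open>s\<close> only \<open>of_nat (Suc m)\<close> times the value of \<open>r\<close>
    survives, since the other terms keep a factor \<open>?X\<close>.\<close>
  let ?r = "smult (of_nat (Suc m)) r + ?X * pderiv r - smult (c k) (?X ^ Suc k * q)"
  have "pderiv ?X = 1" by (simp add: pderiv_pCons)
  then have "pderiv (?X ^ Suc m * r) = ?X ^ m * (smult (of_nat (Suc m)) r + ?X * pderiv r)"
    by (simp only: pderiv_mult pderiv_power_Suc) (simp add: algebra_simps)
  moreover have "?X ^ j = ?X ^ m * ?X ^ Suc k"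
    by (metis m power_add add.commute add_Suc)
  ultimately have "flat_output (?X ^ j * q) c (Suc k) = ?X ^ (j - Suc k) * ?r"
    using r(1) m by (simp only: flat_output.simps) (simp add: algebra_simps)
  moreover have "poly ?r s \<noteq> 0"
    using r(2) by simp
  ultimately show ?case by blast
qed

text \<open>By the recursion, the derivative of the \<open>i\<close>-th coefficient is the
  coefficient one index lower plus \<open>a i\<close> times \<open>\<phi>\<close>. By
  \<open>dep\<close> the latter parts add up to \<open>\<phi>\<close> times
  \<open>(f ^^ d) v\<close>, which completes the former to a shifted sum.\<close>

lemma flat_trajectory:
  fixes f :: "'a::real_normed_vector \<Rightarrow> 'a" and \<phi> :: "real poly"
  assumes f: "linear f" and dep: "(f ^^ d) v = (\<Sum>i<d. a i *\<^sub>R (f ^^ i) v)"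
  defines "E \<equiv> flat_output \<phi> (\<lambda>k. a (d - Suc k))"
  defines "z \<equiv> \<lambda>\<tau>. \<Sum>i<d. poly (E (d - Suc i)) \<tau> *\<^sub>R (f ^^ i) v"
  shows "(z has_vector_derivative f (z \<tau>) + poly (E d) \<tau> *\<^sub>R v) (at \<tau>)"
proof -
  have E: "pderiv (E (d - Suc i)) = E (d - i) + smult (a i) \<phi>" if "i < d" for i
  proof -
    have "d - i = Suc (d - Suc i)" "d - Suc (d - Suc i) = i" using that by auto
    then show ?thesis by (simp add: E_def)
  qed
  have "(z has_vector_derivative (\<Sum>i<d. poly (pderiv (E (d - Suc i))) \<tau> *\<^sub>R (f ^^ i) v)) (at \<tau>)"
    unfolding z_def
    by (intro has_vector_derivative_sum)
      (auto intro!: derivative_eq_intros poly_DERIV simp: has_real_derivative_iff_has_vector_derivative[symmetric])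
  also have "(\<Sum>i<d. poly (pderiv (E (d - Suc i))) \<tau> *\<^sub>R (f ^^ i) v)
      = (\<Sum>i<d. poly (E (d - i)) \<tau> *\<^sub>R (f ^^ i) v) + poly \<phi> \<tau> *\<^sub>R (f ^^ d) v"
    by (simp add: E dep scaleR_sum_right scaleR_add_left sum.distrib mult.commute)
  \<comment> \<open>Because \<open>E 0\<close> is \<open>\<phi>\<close>, the extra term is the one
    for \<open>i = d\<close>. Splitting off \<open>i = 0\<close> instead isolates the control term,
    and the remaining sum is the image of \<open>z \<tau>\<close> under \<open>f\<close>.\<close>
  also have "\<dots> = (\<Sum>i<Suc d. poly (E (d - i)) \<tau> *\<^sub>R (f ^^ i) v)"
    by (simp add: E_def)
  also have "\<dots> = f (z \<tau>) + poly (E d) \<tau> *\<^sub>R v"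
    by (subst sum.lessThan_Suc_shift) (simp add: z_def linear_sum[OF f] linear_cmul[OF f])
  finally show ?thesis .
qed

section \<open>States that can be steered to zero\<close>

text \<open>No order between \<open>s\<close> and \<open>t\<close> is imposed: with the times
  exchanged, the same set describes the states that can be reached from 0.\<close>

definition null_steerable :: "('a::real_normed_vector \<Rightarrow> 'a) \<Rightarrow> ('b::real_normed_vector \<Rightarrow> 'a) \<Rightarrow> real \<Rightarrow> real \<Rightarrow> 'a set"
  where "null_steerable f g s t =
    {p. \<exists>z u. (\<forall>\<tau>. (z has_vector_derivative f (z \<tau>) + g (u \<tau>)) (at \<tau>)) \<and>
              continuous_on UNIV u \<and> z s = p \<and> z t = 0}"

lemma null_steerableI:
  assumes "\<And>\<tau>. (z has_vector_derivative f (z \<tau>) + g (u \<tau>)) (at \<tau>)"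
    "continuous_on UNIV u" "z s = p" "z t = 0"
  shows "p \<in> null_steerable f g s t"
  using assms unfolding null_steerable_def by blast

lemma null_steerableE:
  assumes "p \<in> null_steerable f g s t"
  obtains z u where "\<And>\<tau>. (z has_vector_derivative f (z \<tau>) + g (u \<tau>)) (at \<tau>)"
    "continuous_on UNIV u" "z s = p" "z t = 0"
  using assms unfolding null_steerable_def by blast

lemma subspace_null_steerable:
  assumes f: "linear f" and g: "linear g"
  shows "subspace (null_steerable f g s t)"
proof (rule subspaceI)
  show "0 \<in> null_steerable f g s t"
    by (rule null_steerableI[where z = "\<lambda>_. 0" and u = "\<lambda>_. 0"])
      (auto simp: linear_0[OF f] linear_0[OF g])
next
  fix p q assume "p \<in> null_steerable f g s t" "q \<in> null_steerable f g s t"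
  then obtain z u y w
    where z: "\<And>\<tau>. (z has_vector_derivative f (z \<tau>) + g (u \<tau>)) (at \<tau>)" "z s = p" "z t = 0"
      and y: "\<And>\<tau>. (y has_vector_derivative f (y \<tau>) + g (w \<tau>)) (at \<tau>)" "y s = q" "y t = 0"
      and u: "continuous_on UNIV u" "continuous_on UNIV w"
    by (metis null_steerableE)
  show "p + q \<in> null_steerable f g s t"
  proof (rule null_steerableI[where z = "\<lambda>\<tau>. z \<tau> + y \<tau>" and u = "\<lambda>\<tau>. u \<tau> + w \<tau>"])
    show "((\<lambda>\<tau>. z \<tau> + y \<tau>) has_vector_derivative f (z \<tau> + y \<tau>) + g (u \<tau> + w \<tau>)) (at \<tau>)" for \<tau>
      using has_vector_derivative_add[OF z(1) y(1), of \<tau>]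
      by (simp add: linear_add[OF f] linear_add[OF g] algebra_simps)
  qed (use z y u in \<open>auto intro!: continuous_intros\<close>)
next
  fix c p assume "p \<in> null_steerable f g s t"
  then obtain z u
    where z: "\<And>\<tau>. (z has_vector_derivative f (z \<tau>) + g (u \<tau>)) (at \<tau>)" "z s = p" "z t = 0"
      and u: "continuous_on UNIV u"
    by (metis null_steerableE)
  show "c *\<^sub>R p \<in> null_steerable f g s t"
  proof (rule null_steerableI[where z = "\<lambda>\<tau>. c *\<^sub>R z \<tau>" and u = "\<lambda>\<tau>. c *\<^sub>R u \<tau>"])
    show "((\<lambda>\<tau>. c *\<^sub>R z \<tau>) has_vector_derivative f (c *\<^sub>R z \<tau>) + g (c *\<^sub>R u \<tau>)) (at \<tau>)" for \<tau>
      using bounded_linear.has_vector_derivative[OF bounded_linear_scaleR_right z(1)[of \<tau>], of c]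
      by (simp add: linear_cmul[OF f] linear_cmul[OF g] algebra_simps)
  qed (use z u in \<open>auto intro!: continuous_intros\<close>)
qed

text \<open>Strong induction on \<open>i < d\<close>: the value at \<open>s\<close> of a suitable
  flat trajectory is a nonzero multiple of the \<open>i\<close>-th iterate plus lower iterates,
  which are already known to be steerable and can be subtracted. The dependence then covers the
  iterates from \<open>d\<close> on.\<close>

lemma krylov_null_steerable:
  fixes f :: "'a::euclidean_space \<Rightarrow> 'a" and g :: "'b::real_normed_vector \<Rightarrow> 'a"
  assumes f: "linear f" and g: "linear g" and "s \<noteq> t"
  shows "(f ^^ k) (g y) \<in> null_steerable f g s t"
proof -
  let ?V = "null_steerable f g s t"
  obtain d a where dep: "(f ^^ d) (g y) = (\<Sum>i<d. a i *\<^sub>R (f ^^ i) (g y))"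
    using krylov_dependence by blast
  note V = subspace_null_steerable[OF f g, of s t]
  have "(f ^^ i) (g y) \<in> ?V" if "i < d" for i
    using that
  proof (induction i rule: less_induct)
    case (less i)
    let ?j = "d - Suc i"
    \<comment> \<open>The exponent \<open>d\<close> at \<open>t\<close> makes every
      \<open>E k\<close> with \<open>k < d\<close> vanish there. The exponent \<open>?j\<close> at
      \<open>s\<close> makes the coefficients of the iterates above \<open>i\<close> vanish there,
      but not that of the \<open>i\<close>-th.\<close>
    define E where "E = flat_output ([:-s, 1:] ^ ?j * [:-t, 1:] ^ d) (\<lambda>k. a (d - Suc k))"
    define z where "z = (\<lambda>\<tau>. \<Sum>i<d. poly (E (d - Suc i)) \<tau> *\<^sub>R (f ^^ i) (g y))"
    have Es: "\<exists>r. E k = [:-s, 1:] ^ (?j - k) * r \<and> poly r s \<noteq> 0" if "k \<le> ?j" for k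
      unfolding E_def using that \<open>s \<noteq> t\<close> by (intro flat_output_order) (simp add: poly_power)
    have Et: "\<exists>r. E k = [:-t, 1:] ^ (d - k) * r \<and> poly r t \<noteq> 0" if "k \<le> d" for k
      unfolding E_def using that \<open>s \<noteq> t\<close>
      by (subst mult.commute, intro flat_output_order) (simp add: poly_power)
    have "poly (E k) t = 0" if "k < d" for k
      using Et[of k] that by (auto simp: poly_power)
    then have "z t = 0" by (simp add: z_def)
    have "poly (E k) s = 0" if "k < ?j" for k
      using Es[of k] that by (auto simp: poly_power)
    then have "poly (E (d - Suc k)) s = 0" if "i < k" "k < d" for k
      using that by simp
    then have "z s = (\<Sum>k<Suc i. poly (E (d - Suc k)) s *\<^sub>R (f ^^ k) (g y))"
      unfolding z_def using less.prems by (intro sum.mono_neutral_right) auto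
    then have zs: "z s = poly (E ?j) s *\<^sub>R (f ^^ i) (g y)
        + (\<Sum>k<i. poly (E (d - Suc k)) s *\<^sub>R (f ^^ k) (g y))"
      by simp
    have nz: "poly (E ?j) s \<noteq> 0"
      using Es[of ?j] by auto
    have "z s \<in> ?V"
    proof (rule null_steerableI[where z = z and u = "\<lambda>\<tau>. poly (E d) \<tau> *\<^sub>R y"])
      show "(z has_vector_derivative f (z \<tau>) + g (poly (E d) \<tau> *\<^sub>R y)) (at \<tau>)" for \<tau>
        using flat_trajectory[OF f dep] by (simp add: z_def E_def linear_cmul[OF g])
    qed (use \<open>z t = 0\<close> in \<open>auto intro!: continuous_intros\<close>)
    moreover have "(\<Sum>k<i. poly (E (d - Suc k)) s *\<^sub>R (f ^^ k) (g y)) \<in> ?V"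
      using less by (intro subspace_sum V subspace_scale) auto
    ultimately have "poly (E ?j) s *\<^sub>R (f ^^ i) (g y) \<in> ?V"
      using subspace_diff[OF V] zs by fastforce
    then show ?case
      using subspace_scale[OF V, of "poly (E ?j) s *\<^sub>R (f ^^ i) (g y)" "1 / poly (E ?j) s"] nz
      by simp
  qed
  then show ?thesis
    using krylov_subset[OF f dep V] by blast
qed

section \<open>Absolutely continuous functions on an interval\<close>

lemma abs_continuous_on_intervalE:
  fixes f :: "real \<Rightarrow> 'a::real_normed_vector"
  assumes "abs_continuous_on_interval a b f" "\<epsilon> > 0"
  obtains \<delta> where "\<delta> > 0" "\<And>N s t. \<forall>i<N. a \<le> s i \<and> s i \<le> t i \<and> t i \<le> b \<Longrightarrow>
      disjoint_family_on (\<lambda>i. {s i<..<t i}) {..<N::nat} \<Longrightarrow> (\<Sum>i<N. t i - s i) < \<delta> \<Longrightarrow>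
      (\<Sum>i<N. norm (f (t i) - f (s i))) < \<epsilon>"
proof -
  obtain \<delta> where "\<delta> > 0" and \<delta>: "\<forall>(N::nat) s t. (\<forall>i<N. a \<le> s i \<and> s i \<le> t i \<and> t i \<le> b) \<longrightarrow>
      disjoint_family_on (\<lambda>i. {s i<..<t i}) {..<N} \<longrightarrow> (\<Sum>i<N. t i - s i) < \<delta> \<longrightarrow>
      (\<Sum>i<N. norm (f (t i) - f (s i))) < \<epsilon>"
    using assms(1)[unfolded abs_continuous_on_interval_def, THEN spec, THEN mp, OF assms(2)]
    by (elim exE conjE) (rule that)
  show thesis
    by (rule that[OF \<open>\<delta> > 0\<close>]) (use \<delta> in blast)
qed

lemma abs_continuous_on_interval_dominated:
  fixes f :: "real \<Rightarrow> 'a::real_normed_vector" and g :: "real \<Rightarrow> 'b::real_normed_vector"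
  assumes g: "abs_continuous_on_interval a b g"
    and le: "\<And>s t. a \<le> s \<Longrightarrow> s \<le> t \<Longrightarrow> t \<le> b \<Longrightarrow> norm (f t - f s) \<le> L * norm (g t - g s)"
  shows "abs_continuous_on_interval a b f"
  unfolding abs_continuous_on_interval_def
proof (intro allI impI)
  fix \<epsilon> :: real assume "\<epsilon> > 0"
  \<comment> \<open>\<open>L\<close> may be zero or negative, but \<open>\<epsilon>\<close> has to
    be divided by a positive constant.\<close>
  define K where "K = max L 1"
  have "K > 0" "L \<le> K" by (auto simp: K_def)
  obtain \<delta> where "\<delta> > 0" and \<delta>: "\<And>N s t. \<forall>i<N. a \<le> s i \<and> s i \<le> t i \<and> t i \<le> b \<Longrightarrow>
      disjoint_family_on (\<lambda>i. {s i<..<t i}) {..<N::nat} \<Longrightarrow> (\<Sum>i<N. t i - s i) < \<delta> \<Longrightarrow>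
      (\<Sum>i<N. norm (g (t i) - g (s i))) < \<epsilon> / K"
    using abs_continuous_on_intervalE[OF g divide_pos_pos[OF \<open>\<epsilon> > 0\<close> \<open>K > 0\<close>]] by blast
  show "\<exists>\<delta>>0. \<forall>(N::nat) s t. (\<forall>i<N. a \<le> s i \<and> s i \<le> t i \<and> t i \<le> b) \<longrightarrow>
      disjoint_family_on (\<lambda>i. {s i<..<t i}) {..<N} \<longrightarrow> (\<Sum>i<N. t i - s i) < \<delta> \<longrightarrow>
      (\<Sum>i<N. norm (f (t i) - f (s i))) < \<epsilon>"
  proof (intro exI[of _ \<delta>] conjI allI impI)
    fix N :: nat and s t :: "nat \<Rightarrow> real"
    assume st: "\<forall>i<N. a \<le> s i \<and> s i \<le> t i \<and> t i \<le> b"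
      "disjoint_family_on (\<lambda>i. {s i<..<t i}) {..<N}" "(\<Sum>i<N. t i - s i) < \<delta>"
    have "norm (f (t i) - f (s i)) \<le> K * norm (g (t i) - g (s i))" if "i < N" for i
    proof -
      have "norm (f (t i) - f (s i)) \<le> L * norm (g (t i) - g (s i))"
        using le st(1) that by blast
      also have "\<dots> \<le> K * norm (g (t i) - g (s i))"
        using \<open>L \<le> K\<close> by (simp add: mult_right_mono)
      finally show ?thesis .
    qed
    then have "(\<Sum>i<N. norm (f (t i) - f (s i))) \<le> K * (\<Sum>i<N. norm (g (t i) - g (s i)))"
      by (auto simp: sum_distrib_left intro: sum_mono)
    also have "\<dots> < \<epsilon>"
      using \<delta>[OF st] \<open>K > 0\<close> by (simp add: field_simps)
    finally show "(\<Sum>i<N. norm (f (t i) - f (s i))) < \<epsilon>" .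
  qed fact
qed

lemma abs_continuous_on_interval_ident: "abs_continuous_on_interval a b (\<lambda>t::real. t)"
  unfolding abs_continuous_on_interval_def by (intro allI impI exI conjI) auto

lemma abs_continuous_on_interval_diff:
  assumes f: "abs_continuous_on_interval a b f" and g: "abs_continuous_on_interval a b g"
  shows "abs_continuous_on_interval a b (\<lambda>t. f t - g t)"
  unfolding abs_continuous_on_interval_def
proof (intro allI impI)
  fix \<epsilon> :: real assume "\<epsilon> > 0"
  then have "\<epsilon> / 2 > 0" by simp
  obtain \<delta> where "\<delta> > 0" and \<delta>: "\<And>N s t. \<forall>i<N. a \<le> s i \<and> s i \<le> t i \<and> t i \<le> b \<Longrightarrow>
      disjoint_family_on (\<lambda>i. {s i<..<t i}) {..<N::nat} \<Longrightarrow> (\<Sum>i<N. t i - s i) < \<delta> \<Longrightarrow>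
      (\<Sum>i<N. norm (f (t i) - f (s i))) < \<epsilon> / 2"
    using abs_continuous_on_intervalE[OF f \<open>\<epsilon> / 2 > 0\<close>] by blast
  obtain \<eta> where "\<eta> > 0" and \<eta>: "\<And>N s t. \<forall>i<N. a \<le> s i \<and> s i \<le> t i \<and> t i \<le> b \<Longrightarrow>
      disjoint_family_on (\<lambda>i. {s i<..<t i}) {..<N::nat} \<Longrightarrow> (\<Sum>i<N. t i - s i) < \<eta> \<Longrightarrow>
      (\<Sum>i<N. norm (g (t i) - g (s i))) < \<epsilon> / 2"
    using abs_continuous_on_intervalE[OF g \<open>\<epsilon> / 2 > 0\<close>] by blast
  show "\<exists>\<delta>>0. \<forall>(N::nat) s t. (\<forall>i<N. a \<le> s i \<and> s i \<le> t i \<and> t i \<le> b) \<longrightarrow>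
      disjoint_family_on (\<lambda>i. {s i<..<t i}) {..<N} \<longrightarrow> (\<Sum>i<N. t i - s i) < \<delta> \<longrightarrow>
      (\<Sum>i<N. norm ((f (t i) - g (t i)) - (f (s i) - g (s i)))) < \<epsilon>"
  proof (intro exI[of _ "min \<delta> \<eta>"] conjI allI impI)
    fix N :: nat and s t :: "nat \<Rightarrow> real"
    assume st: "\<forall>i<N. a \<le> s i \<and> s i \<le> t i \<and> t i \<le> b"
      "disjoint_family_on (\<lambda>i. {s i<..<t i}) {..<N}" "(\<Sum>i<N. t i - s i) < min \<delta> \<eta>"
    have "(\<Sum>i<N. norm ((f (t i) - g (t i)) - (f (s i) - g (s i))))
        = (\<Sum>i<N. norm ((f (t i) - f (s i)) - (g (t i) - g (s i))))"
      by (simp add: algebra_simps)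
    also have "\<dots> \<le> (\<Sum>i<N. norm (f (t i) - f (s i))) + (\<Sum>i<N. norm (g (t i) - g (s i)))"
      unfolding sum.distrib[symmetric] by (intro sum_mono norm_triangle_ineq4)
    also have "\<dots> < \<epsilon>"
      using \<delta>[OF st(1,2)] \<eta>[OF st(1,2)] st(3) by simp
    finally show "(\<Sum>i<N. norm ((f (t i) - g (t i)) - (f (s i) - g (s i)))) < \<epsilon>" .
  qed (use \<open>\<delta> > 0\<close> \<open>\<eta> > 0\<close> in simp)
qed

lemma abs_continuous_on_interval_imp_continuous_on:
  fixes f :: "real \<Rightarrow> 'a::real_normed_vector"
  assumes "abs_continuous_on_interval a b f"
  shows "continuous_on {a..b} f"
  unfolding continuous_on_iff
proof (intro ballI allI impI)
  fix x \<epsilon> :: real assume x: "x \<in> {a..b}" and "\<epsilon> > 0"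
  obtain \<delta> where "\<delta> > 0" and \<delta>: "\<And>N s t. \<forall>i<N. a \<le> s i \<and> s i \<le> t i \<and> t i \<le> b \<Longrightarrow>
      disjoint_family_on (\<lambda>i. {s i<..<t i}) {..<N::nat} \<Longrightarrow> (\<Sum>i<N. t i - s i) < \<delta> \<Longrightarrow>
      (\<Sum>i<N. norm (f (t i) - f (s i))) < \<epsilon>"
    using abs_continuous_on_intervalE[OF assms \<open>\<epsilon> > 0\<close>] by blast
  have "dist (f y) (f x) < \<epsilon>" if y: "y \<in> {a..b}" "dist y x < \<delta>" for y
  proof -
    \<comment> \<open>A family of one interval suffices; \<open>min\<close> and \<open>max\<close>
      put its ends in order.\<close>
    have "(\<Sum>i<1::nat. norm (f (max x y) - f (min x y))) < \<epsilon>"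
      using x y by (intro \<delta>) (auto simp: disjoint_family_on_def dist_real_def)
    then show ?thesis
      by (cases "x \<le> y") (auto simp: dist_norm max_def min_def norm_minus_commute)
  qed
  then show "\<exists>d>0. \<forall>y\<in>{a..b}. dist y x < d \<longrightarrow> dist (f y) (f x) < \<epsilon>"
    using \<open>\<delta> > 0\<close> by blast
qed

text \<open>By compactness \<open>f\<close> is bounded, so the factor \<open>f t + f s\<close> of
  the difference of squares is bounded as well.\<close>

lemma abs_continuous_on_interval_power2:
  fixes f :: "real \<Rightarrow> real"
  assumes f: "abs_continuous_on_interval a b f"
  shows "abs_continuous_on_interval a b (\<lambda>t. (f t)\<^sup>2)"
proof -
  have "bounded (f ` {a..b})"
    using abs_continuous_on_interval_imp_continuous_on[OF f]
    by (intro compact_imp_bounded compact_continuous_image) auto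
  then obtain K where K: "\<And>t. t \<in> {a..b} \<Longrightarrow> \<bar>f t\<bar> \<le> K"
    unfolding bounded_iff real_norm_def by blast
  show ?thesis
  proof (rule abs_continuous_on_interval_dominated[OF f])
    fix s t assume st: "a \<le> s" "s \<le> t" "t \<le> b"
    have "(f t)\<^sup>2 - (f s)\<^sup>2 = (f t + f s) * (f t - f s)"
      by (simp add: power2_eq_square algebra_simps)
    moreover have "\<bar>f t + f s\<bar> \<le> 2 * K"
      using K[of s] K[of t] st by (auto simp: abs_le_iff)
    ultimately show "norm ((f t)\<^sup>2 - (f s)\<^sup>2) \<le> (2 * K) * norm (f t - f s)"
      by (simp add: abs_mult mult_right_mono)
  qed
qed

section \<open>Monotonicity from the sign of the derivative almost everywhere\<close>

text \<open>Tagged divisions are finite sets of pairs, whereas the definition numbers its intervals;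
  a bijection transfers the estimate.\<close>

lemma abs_continuous_on_finite_family:
  fixes f :: "real \<Rightarrow> 'a::real_normed_vector"
  assumes f: "abs_continuous_on_interval a b f" and "\<epsilon> > 0"
  obtains \<delta> where "\<delta> > 0" "\<And>I (s::'i \<Rightarrow> real) t. finite I \<Longrightarrow>
      (\<And>i. i \<in> I \<Longrightarrow> a \<le> s i \<and> s i \<le> t i \<and> t i \<le> b) \<Longrightarrow>
      disjoint_family_on (\<lambda>i. {s i<..<t i}) I \<Longrightarrow> (\<Sum>i\<in>I. t i - s i) < \<delta> \<Longrightarrow>
      (\<Sum>i\<in>I. norm (f (t i) - f (s i))) < \<epsilon>"
proof -
  obtain \<delta> where "\<delta> > 0" and \<delta>: "\<And>N s t. \<forall>i<N. a \<le> s i \<and> s i \<le> t i \<and> t i \<le> b \<Longrightarrow>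
      disjoint_family_on (\<lambda>i. {s i<..<t i}) {..<N::nat} \<Longrightarrow> (\<Sum>i<N. t i - s i) < \<delta> \<Longrightarrow>
      (\<Sum>i<N. norm (f (t i) - f (s i))) < \<epsilon>"
    using abs_continuous_on_intervalE[OF f \<open>\<epsilon> > 0\<close>] by blast
  show thesis
  proof (rule that[OF \<open>\<delta> > 0\<close>])
    fix I and s t :: "'i \<Rightarrow> real"
    assume I: "finite I" "\<And>i. i \<in> I \<Longrightarrow> a \<le> s i \<and> s i \<le> t i \<and> t i \<le> b"
      "disjoint_family_on (\<lambda>i. {s i<..<t i}) I" "(\<Sum>i\<in>I. t i - s i) < \<delta>"
    obtain h where h: "bij_betw h {..<card I} I"
      using ex_bij_betw_nat_finite[OF I(1)] by (auto simp: atLeast0LessThan)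
    have hI: "h i \<in> I" if "i < card I" for i
      using bij_betwE[OF h] that by auto
    have "disjoint_family_on (\<lambda>i. {(s \<circ> h) i<..<(t \<circ> h) i}) {..<card I}"
    proof -
      have "disjoint_family_on (\<lambda>i. {s i<..<t i}) (h ` {..<card I})"
        using I(3) h by (simp add: bij_betw_def)
      then show ?thesis
        using bij_betw_imp_inj_on[OF h] unfolding disjoint_family_on_def inj_on_def comp_def
        by blast
    qed
    moreover have "(\<Sum>i<card I. (t \<circ> h) i - (s \<circ> h) i) < \<delta>"
      using I(4) sum.reindex_bij_betw[OF h, of "\<lambda>i. t i - s i"] by simp
    ultimately have "(\<Sum>i<card I. norm (f ((t \<circ> h) i) - f ((s \<circ> h) i))) < \<epsilon>"
      using I(2) hI by (intro \<delta>) auto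
    then show "(\<Sum>i\<in>I. norm (f (t i) - f (s i))) < \<epsilon>"
      using sum.reindex_bij_betw[OF h, of "\<lambda>i. norm (f (t i) - f (s i))"] by simp
  qed
qed

text \<open>Turns an open cover of small measure into the small total length that absolute
  continuity asks for.\<close>

lemma sum_length_le_measure:
  fixes s t :: "'i \<Rightarrow> real"
  assumes "finite I" "\<And>i. i \<in> I \<Longrightarrow> s i \<le> t i" "disjoint_family_on (\<lambda>i. {s i<..<t i}) I"
    and "\<And>i. i \<in> I \<Longrightarrow> {s i<..<t i} \<subseteq> U" and U: "U \<in> lmeasurable"
  shows "(\<Sum>i\<in>I. t i - s i) \<le> measure lebesgue U"
proof -
  have "(\<Sum>i\<in>I. t i - s i) = (\<Sum>i\<in>I. measure lebesgue {s i<..<t i})"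
    using assms(2) by simp
  also have "\<dots> = measure lebesgue (\<Union>i\<in>I. {s i<..<t i})"
    using assms(1-3) by (intro measure_finite_Union[symmetric]) (auto simp: emeasure_lborel_Ioo)
  also have "\<dots> \<le> measure lebesgue U"
    using assms(1,4) U by (intro measure_mono_fmeasurable) auto
  finally show ?thesis .
qed

text \<open>
  Cousin's lemma for a gauge which confines cells tagged in the exceptional null set to a small open
  cover of it: those cells contribute little by absolute continuity, all others by the derivative bound.
\<close>
lemma abs_continuous_deriv_nonpos_imp_le:
  fixes f :: "real \<Rightarrow> real"
  assumes "a \<le> b" and f: "abs_continuous_on_interval a b f"
    and deriv: "AE t in lebesgue_on {a<..<b}. \<exists>D\<le>0. (f has_real_derivative D) (at t)"
  shows "f b \<le> f a"
proof (rule field_le_epsilon)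
  fix e :: real assume "e > 0"
  \<comment> \<open>The regular cells will contribute at most \<open>\<epsilon> * (b - a)\<close>
    and the exceptional ones at most \<open>\<epsilon>\<close>. The summand 1 keeps the denominator
    positive even for \<open>a = b\<close>.\<close>
  define \<epsilon> where "\<epsilon> = e / (b - a + 1)"
  have "\<epsilon> > 0" and \<epsilon>: "\<epsilon> * (b - a) + \<epsilon> = e"
  proof -
    have "\<epsilon> * (b - a + 1) = e" using \<open>a \<le> b\<close> by (simp add: \<epsilon>_def)
    then show "\<epsilon> * (b - a) + \<epsilon> = e" by (simp add: algebra_simps)
  qed (use \<open>e > 0\<close> \<open>a \<le> b\<close> in \<open>simp add: \<epsilon>_def\<close>)
  have "AE t in lebesgue. t \<in> {a<..<b} \<longrightarrow> (\<exists>D\<le>0. (f has_real_derivative D) (at t))"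
    using deriv by (subst (asm) AE_restrict_space_iff) auto
  then obtain N where N: "negligible N"
    "{t. \<not> (t \<in> {a<..<b} \<longrightarrow> (\<exists>D\<le>0. (f has_real_derivative D) (at t)))} \<subseteq> N"
    unfolding eventually_ae_filter_negligible by (elim exE conjE)
  \<comment> \<open>The hypothesis speaks of interior points only, so the endpoints count as
    exceptional.\<close>
  define Z where "Z = N \<union> {a, b}"
  have "negligible Z"
    using N(1) by (simp add: Z_def)
  then have Z: "Z \<in> null_sets lebesgue"
    by (simp add: negligible_iff_null_sets)
  obtain \<delta> where "\<delta> > 0" and \<delta>: "\<And>I (s::real \<times> real set \<Rightarrow> real) t. finite I \<Longrightarrow>
      (\<And>i. i \<in> I \<Longrightarrow> a \<le> s i \<and> s i \<le> t i \<and> t i \<le> b) \<Longrightarrow>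
      disjoint_family_on (\<lambda>i. {s i<..<t i}) I \<Longrightarrow> (\<Sum>i\<in>I. t i - s i) < \<delta> \<Longrightarrow>
      (\<Sum>i\<in>I. norm (f (t i) - f (s i))) < \<epsilon>"
    using abs_continuous_on_finite_family[OF f \<open>\<epsilon> > 0\<close>, where 'i = "real \<times> real set"] by blast
  obtain U where U: "open U" "Z \<subseteq> U" "U - Z \<in> lmeasurable" "emeasure lebesgue (U - Z) < ennreal \<delta>"
    using sets_lebesgue_outer_open[of Z \<delta>] Z \<open>\<delta> > 0\<close> by auto
  have "U = (U - Z) \<union> Z" using U(2) by auto
  then have Um: "U \<in> lmeasurable"
    using fmeasurable.Un[OF U(3) negligible_imp_measurable[OF \<open>negligible Z\<close>]] by simp
  have "measure lebesgue U = measure lebesgue (U - Z)"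
    using measure_Diff_null_set[OF _ Z, of U] Um by (simp add: fmeasurableD)
  also have "\<dots> < \<delta>"
    using U(3,4) \<open>\<delta> > 0\<close> by (simp add: emeasure_eq_measure2 ennreal_less_iff)
  finally have mU: "measure lebesgue U < \<delta>" .
  \<comment> \<open>The two sides of \<open>x\<close> are treated separately because a tag lies
    between the ends of its cell; the two estimates add up to a bound over the cell.\<close>
  define good where "good x d \<longleftrightarrow> d > 0 \<and> (\<forall>y. \<bar>y - x\<bar> < d \<longrightarrow>
      (y \<ge> x \<longrightarrow> f y - f x \<le> \<epsilon> * (y - x)) \<and> (y \<le> x \<longrightarrow> f x - f y \<le> \<epsilon> * (x - y)))" for x d
  have "\<exists>d. good x d" if x: "x \<in> {a..b}" "x \<notin> Z" for x
  proof -
    obtain D where D: "D \<le> 0" "(f has_real_derivative D) (at x)"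
      using N(2) x by (force simp: Z_def)
    then have "\<forall>e>0. \<exists>d>0. \<forall>y. norm (y - x) < d \<longrightarrow> norm (f y - f x - D * (y - x)) \<le> e * norm (y - x)"
      by (simp add: has_field_derivative_def has_derivative_at_alt)
    then obtain d where "d > 0" and d: "\<And>y. \<bar>y - x\<bar> < d \<Longrightarrow> \<bar>f y - f x - D * (y - x)\<bar> \<le> \<epsilon> * \<bar>y - x\<bar>"
      using \<open>\<epsilon> > 0\<close> unfolding real_norm_def by blast
    have "good x d"
      unfolding good_def
    proof (intro conjI allI impI)
      fix y assume "\<bar>y - x\<bar> < d"
      note y = d[OF this]
      show "f y - f x \<le> \<epsilon> * (y - x)" if "y \<ge> x"
        using y that D(1) mult_nonpos_nonneg[of D "y - x"] by simp
      show "f x - f y \<le> \<epsilon> * (x - y)" if "y \<le> x"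
        using y that D(1) mult_nonpos_nonpos[of D "y - x"] by simp
    qed fact
    then show ?thesis ..
  qed
  then obtain d where d: "\<And>x. x \<in> {a..b} \<Longrightarrow> x \<notin> Z \<Longrightarrow> good x (d x)"
    by metis
  \<comment> \<open>The last branch only serves to make \<open>\<gamma>\<close> a gauge on the whole
    line.\<close>
  define \<gamma> where "\<gamma> x = (if x \<in> Z then U else if x \<in> {a..b} then ball x (d x) else ball x 1)" for x
  have "gauge \<gamma>"
    unfolding gauge_def using U(1,2) d by (auto simp: \<gamma>_def good_def)
  then obtain p where p: "p tagged_division_of {a..b}" "\<gamma> fine p"
    using fine_division_exists_real by blast
  \<comment> \<open>Cells are nonempty compact intervals, so \<open>Inf\<close> and
    \<open>Sup\<close> recover their ends, in the form in which the telescoping sum over a tagged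
    division is stated.\<close>
  define l where "l = (\<lambda>q::real \<times> real set. Inf (snd q))"
  define r where "r = (\<lambda>q::real \<times> real set. Sup (snd q))"
  have "finite p" using tagged_division_ofD(1)[OF p(1)] .
  have q: "fst q \<in> snd q \<and> snd q = {l q..r q} \<and> l q \<le> fst q \<and> fst q \<le> r q \<and> a \<le> l q \<and> r q \<le> b
      \<and> snd q \<subseteq> \<gamma> (fst q)" if "q \<in> p" for q
  proof -
    obtain x K where qe: "q = (x, K)" by (cases q)
    then have xK: "(x, K) \<in> p" using that by simp
    note K = tagged_division_ofD(2,3)[OF p(1) xK] fineD[OF p(2) xK]
    obtain u v where uv: "K = {u..v}"
      using tagged_division_ofD(4)[OF p(1) xK] by auto
    have "u \<le> v" using K(1) uv by simp
    then show ?thesis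
      using K by (simp add: l_def r_def qe uv)
  qed
  have disj: "disjoint_family_on (\<lambda>q. {l q<..<r q}) p"
    unfolding disjoint_family_on_def
  proof (intro ballI impI)
    fix q q' assume qq: "q \<in> p" "q' \<in> p" "q \<noteq> q'"
    then have "interior (snd q) \<inter> interior (snd q') = {}"
      using tagged_division_ofD(5)[OF p(1), of "fst q" "snd q" "fst q'" "snd q'"] by simp
    moreover have "snd q = {l q..r q}" "snd q' = {l q'..r q'}"
      using q qq by blast+
    ultimately show "{l q<..<r q} \<inter> {l q'<..<r q'} = {}"
      by (metis interior_atLeastAtMost_real)
  qed
  define bad where "bad = {q \<in> p. fst q \<in> Z}"
  have "bad \<subseteq> p" by (auto simp: bad_def)
  have badU: "{l q<..<r q} \<subseteq> U" if "q \<in> bad" for q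
  proof -
    have "snd q = {l q..r q}" "snd q \<subseteq> U"
      using q[of q] that by (auto simp: bad_def \<gamma>_def)
    then show ?thesis by force
  qed
  have "finite bad" using \<open>finite p\<close> by (simp add: bad_def)
  have dbad: "disjoint_family_on (\<lambda>q. {l q<..<r q}) bad"
    using disj \<open>bad \<subseteq> p\<close> by (rule disjoint_family_on_mono[rotated])
  have ord: "a \<le> l q" "l q \<le> r q" "r q \<le> b" if "q \<in> p" for q
    using q[OF that] by auto
  have "(\<Sum>q\<in>bad. r q - l q) \<le> measure lebesgue U"
    using \<open>finite bad\<close> ord \<open>bad \<subseteq> p\<close> by (intro sum_length_le_measure dbad badU Um) auto
  then have "(\<Sum>q\<in>bad. norm (f (r q) - f (l q))) < \<epsilon>"
    using ord \<open>bad \<subseteq> p\<close> mU by (intro \<delta> \<open>finite bad\<close> dbad) auto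
  moreover have "(\<Sum>q\<in>bad. f (r q) - f (l q)) \<le> (\<Sum>q\<in>bad. norm (f (r q) - f (l q)))"
    by (intro sum_mono) simp
  ultimately have 1: "(\<Sum>q\<in>bad. f (r q) - f (l q)) \<le> \<epsilon>"
    by linarith
  have "(\<Sum>q\<in>p - bad. f (r q) - f (l q)) \<le> (\<Sum>q\<in>p - bad. \<epsilon> * (r q - l q))"
  proof (rule sum_mono)
    fix q assume "q \<in> p - bad"
    then have "q \<in> p" "fst q \<notin> Z" by (auto simp: bad_def)
    note qq = q[OF this(1)]
    then have x: "fst q \<in> {a..b}" by auto
    then have "\<gamma> (fst q) = ball (fst q) (d (fst q))"
      using \<open>fst q \<notin> Z\<close> by (simp add: \<gamma>_def)
    then have "snd q \<subseteq> ball (fst q) (d (fst q))"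
      using qq by metis
    moreover have "l q \<in> snd q" "r q \<in> snd q" using qq by auto
    ultimately have "\<bar>l q - fst q\<bar> < d (fst q)" "\<bar>r q - fst q\<bar> < d (fst q)"
      by (auto simp: dist_real_def abs_minus_commute)
    then have "f (fst q) - f (l q) \<le> \<epsilon> * (fst q - l q)" "f (r q) - f (fst q) \<le> \<epsilon> * (r q - fst q)"
      using d[OF x \<open>fst q \<notin> Z\<close>] qq unfolding good_def by blast+
    then show "f (r q) - f (l q) \<le> \<epsilon> * (r q - l q)"
      by (simp add: algebra_simps)
  qed
  \<comment> \<open>The terms are nonnegative, so the exceptional cells may be added; the lengths of
    all cells then telescope.\<close>
  also have "\<dots> \<le> (\<Sum>q\<in>p. \<epsilon> * (r q - l q))"
    using \<open>finite p\<close> ord \<open>\<epsilon> > 0\<close> by (intro sum_mono2) auto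
  also have "\<dots> = \<epsilon> * (b - a)"
    using additive_tagged_division_1[OF \<open>a \<le> b\<close> p(1), of "\<lambda>t. t"]
    by (simp add: sum_distrib_left[symmetric] l_def r_def case_prod_unfold)
  finally have 2: "(\<Sum>q\<in>p - bad. f (r q) - f (l q)) \<le> \<epsilon> * (b - a)" .
  have "f b - f a = (\<Sum>q\<in>p. f (r q) - f (l q))"
    using additive_tagged_division_1[OF \<open>a \<le> b\<close> p(1), of f]
    by (simp add: l_def r_def case_prod_unfold)
  also have "\<dots> = (\<Sum>q\<in>p - bad. f (r q) - f (l q)) + (\<Sum>q\<in>bad. f (r q) - f (l q))"
    using \<open>finite p\<close> \<open>bad \<subseteq> p\<close> by (rule sum.subset_diff[rotated])
  finally show "f b \<le> f a + e"
    using 1 2 \<epsilon> by linarith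
qed

section \<open>Regularity of smooth curves and continuous controls\<close>

text \<open>The derivative is bounded by compactness, so \<open>x\<close> is Lipschitz, that is,
  dominated by the identity.\<close>

lemma C1_imp_abs_continuous_on_interval:
  fixes x :: "real \<Rightarrow> 'a::real_normed_vector"
  assumes deriv: "\<And>t. t \<in> {a..b} \<Longrightarrow> (x has_vector_derivative x' t) (at t within {a..b})"
    and cont: "continuous_on {a..b} x'"
  shows "abs_continuous_on_interval a b x"
proof -
  have "bounded (x' ` {a..b})"
    using cont by (intro compact_imp_bounded compact_continuous_image) auto
  then obtain K where K: "\<And>t. t \<in> {a..b} \<Longrightarrow> norm (x' t) \<le> K"
    unfolding bounded_iff by blast
  show ?thesis
  proof (rule abs_continuous_on_interval_dominated[OF abs_continuous_on_interval_ident])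
    fix s t assume "a \<le> s" "s \<le> t" "t \<le> b"
    moreover have "onorm (\<lambda>h. h *\<^sub>R x' r) \<le> K" if "r \<in> {a..b}" for r
      using K[OF that] by (intro onorm_le) (simp add: mult.commute[of K] mult_left_mono)
    ultimately show "norm (x t - x s) \<le> K * norm (t - s)"
      using deriv
      by (intro differentiable_bound[where S = "{a..b}" and f' = "\<lambda>t h. h *\<^sub>R x' t"])
        (auto simp: has_vector_derivative_def)
  qed
qed

lemma continuous_on_imp_L_infinity:
  fixes u :: "real \<Rightarrow> real ^ 'm"
  assumes u: "continuous_on UNIV u"
  shows "u \<in> L_infinity s t"
proof -
  have "bounded (u ` {s..t})"
    using continuous_on_subset[OF u] by (intro compact_imp_bounded compact_continuous_image) auto
  then obtain C where C: "\<And>r. r \<in> {s..t} \<Longrightarrow> norm (u r) \<le> C"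
    unfolding bounded_iff by blast
  have "AE r in lebesgue_on {s<..<t}. norm (u r) \<le> C"
    using C by (intro AE_I2) auto
  moreover have "u \<in> borel_measurable (lebesgue_on {s<..<t})"
    using continuous_on_subset[OF u]
    by (intro continuous_imp_measurable_on_sets_lebesgue) auto
  ultimately show ?thesis
    unfolding L_infinity_def by blast
qed

section \<open>Eigenvectors in invariant subspaces\<close>

text \<open>A maximiser \<open>w\<close> of \<open>w \<bullet> f w\<close> on the unit sphere of
  \<open>W\<close> is an eigenvector. The form \<open>Q\<close> is nonnegative on \<open>W\<close>
  and zero at \<open>w\<close>, while moving from \<open>w\<close> along the residual
  \<open>h\<close> changes it to first order by \<open>2 * s * (h \<bullet> h)\<close>; a small
  negative \<open>s\<close> forces \<open>h = 0\<close>.\<close>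

lemma self_adjoint_eigenvector:
  fixes f :: "'a::euclidean_space \<Rightarrow> 'a"
  assumes f: "linear f" and adj: "\<And>v w. f v \<bullet> w = v \<bullet> f w"
    and W: "subspace W" "\<And>w. w \<in> W \<Longrightarrow> f w \<in> W" and ne: "v \<in> W" "v \<noteq> 0"
  obtains w \<mu> where "w \<in> W" "norm w = 1" "f w = \<mu> *\<^sub>R w"
proof -
  let ?S = "W \<inter> sphere 0 1"
  have "compact ?S"
    using closed_Int_compact[OF closed_subspace[OF W(1)] compact_sphere] .
  moreover have "(1 / norm v) *\<^sub>R v \<in> ?S"
    using ne subspace_scale[OF W(1)] by auto
  moreover have "continuous_on ?S (\<lambda>w. w \<bullet> f w)"
    using linear_continuous_on[of f ?S] f
    by (intro continuous_on_inner continuous_on_id) (simp add: linear_conv_bounded_linear)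
  ultimately obtain w where w: "w \<in> ?S" and max: "\<And>h. h \<in> ?S \<Longrightarrow> h \<bullet> f h \<le> w \<bullet> f w"
    using continuous_attains_sup[of ?S "\<lambda>w. w \<bullet> f w"] by blast
  define \<mu> where "\<mu> = w \<bullet> f w"
  define Q where "Q h = \<mu> * (h \<bullet> h) - h \<bullet> f h" for h
  have ww: "w \<bullet> w = 1"
    using w by (simp add: dot_square_norm)
  have Q: "0 \<le> Q h" if "h \<in> W" for h
  proof (cases "h = 0")
    case False
    have "(1 / norm h) *\<^sub>R h \<in> ?S"
      using False that subspace_scale[OF W(1)] by auto
    from max[OF this] have "(h \<bullet> f h) / (norm h)\<^sup>2 \<le> \<mu>"
      by (simp add: \<mu>_def linear_cmul[OF f] power2_eq_square)
    then show ?thesis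
      using False by (simp add: Q_def divide_le_eq dot_square_norm)
  qed (simp add: Q_def linear_0[OF f])
  define h where "h = \<mu> *\<^sub>R w - f w"
  have "h \<in> W"
    using w W by (auto simp: h_def intro!: subspace_diff subspace_scale)
  have expand: "Q (w + s *\<^sub>R h) = 2 * s * (h \<bullet> h) + s\<^sup>2 * Q h" for s
  proof -
    have "h \<bullet> f w = w \<bullet> f h" using adj by (metis inner_commute)
    then have "Q (w + s *\<^sub>R h) = Q w + 2 * s * (\<mu> * (h \<bullet> w) - h \<bullet> f w) + s\<^sup>2 * Q h"
      unfolding Q_def
      by (simp add: linear_add[OF f] linear_cmul[OF f] inner_add_left inner_add_right
          inner_commute[of w h] power2_eq_square algebra_simps)
    moreover have "\<mu> * (h \<bullet> w) - h \<bullet> f w = h \<bullet> h"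
      by (simp add: h_def inner_diff_right)
    moreover have "Q w = 0" by (simp add: Q_def ww \<mu>_def)
    ultimately show ?thesis by simp
  qed
  have "h \<bullet> h = 0"
  proof (rule ccontr)
    assume "h \<bullet> h \<noteq> 0"
    then have pos: "h \<bullet> h > 0" by simp
    \<comment> \<open>This size keeps \<open>s * Q h\<close> above \<open>- (h \<bullet> h)\<close>,
      so the first-order term dominates; the summand 1 covers \<open>Q h = 0\<close>.\<close>
    define s where "s = - (h \<bullet> h) / (1 + Q h)"
    have "s < 0" using pos Q[OF \<open>h \<in> W\<close>] by (simp add: s_def divide_neg_pos)
    have "s * Q h \<ge> - (h \<bullet> h)"
      using pos Q[OF \<open>h \<in> W\<close>] by (simp add: s_def field_simps)
    then have "2 * (h \<bullet> h) + s * Q h > 0" using pos by linarith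
    then have "s * (2 * (h \<bullet> h) + s * Q h) < 0"
      using \<open>s < 0\<close> by (simp add: mult_neg_pos)
    moreover have "w + s *\<^sub>R h \<in> W"
      using w \<open>h \<in> W\<close> W(1) by (auto intro: subspace_add subspace_scale)
    ultimately show False
      using Q[of "w + s *\<^sub>R h"] expand[of s] by (simp add: power2_eq_square algebra_simps)
  qed
  then have "f w = \<mu> *\<^sub>R w" by (simp add: h_def)
  then show thesis using that w by auto
qed

section \<open>Matrices as linear maps, and sufficiency of the span condition\<close>

lemma matrix_vector_mult_uminus_left: "(- A) *v x = - (A *v (x :: real ^ 'n))"
  by (simp add: vec_eq_iff matrix_vector_mult_def sum_negf)

lemma matrix_pow_mult_vector: "matrix_pow M i *v w = ((*v) M ^^ i) w"
  by (induction i) (simp_all add: matrix_vector_mul_assoc[symmetric])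

text \<open>With \<open>b = f p + g q\<close> the state \<open>p\<close> is an equilibrium under the
  constant control \<open>q\<close>. Relative to it the system is linear, and a trajectory from
  \<open>x0 - p\<close> to 0 is superposed with one from 0 to \<open>x1 - p\<close>.\<close>

lemma krylov_span_imp_controllable:
  fixes A :: "real ^ 'n ^ 'n" and B :: "real ^ 'm ^ 'n"
  assumes "T0 < T1"
    and span: "span {matrix_pow (- A) i *v (B *v y) | i y. i < CARD('n)} = (UNIV :: (real ^ 'n) set)"
  shows "controllable A B b T0 T1"
  unfolding controllable_def
proof (intro allI)
  fix x0 x1 :: "real ^ 'n"
  define f where "f = (*v) (- A)"
  define g where "g = (*v) B"
  have f: "linear f" and g: "linear g" by (simp_all add: f_def g_def)
  have full: "v \<in> V" if "subspace V" "\<And>i y. (f ^^ i) (g y) \<in> V" for v V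
  proof -
    have "span {matrix_pow (- A) i *v (B *v y) | i y. i < CARD('n)} \<subseteq> V"
      using that by (intro span_minimal) (auto simp: matrix_pow_mult_vector f_def[symmetric] g_def[symmetric])
    then show ?thesis using span by blast
  qed
  have steer: "v \<in> null_steerable f g s t" if "s \<noteq> t" for v s t
    using full[OF subspace_null_steerable[OF f g] krylov_null_steerable[OF f g that]] .
  \<comment> \<open>Krylov vectors lie in the range of \<open>g\<close> for \<open>i = 0\<close> and
    in that of \<open>f\<close> otherwise, so the sum of the two ranges is the whole space.\<close>
  have "b \<in> {v + w | v w. v \<in> range f \<and> w \<in> range g}"
  proof (rule full)
    show "subspace {v + w | v w. v \<in> range f \<and> w \<in> range g}"
      using f g by (intro subspace_sums linear_subspace_image) auto
    show "(f ^^ i) (g y) \<in> {v + w | v w. v \<in> range f \<and> w \<in> range g}" for i y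
    proof (cases i)
      case 0
      then have "(f ^^ i) (g y) = f 0 + g y" by (simp add: linear_0[OF f])
      then show ?thesis by blast
    next
      case (Suc k)
      then have "(f ^^ i) (g y) = f ((f ^^ k) (g y)) + g 0" by (simp add: linear_0[OF g])
      then show ?thesis by blast
    qed
  qed
  then obtain p q where b: "b = f p + g q" by auto
  have ne: "T0 \<noteq> T1" "T1 \<noteq> T0" using \<open>T0 < T1\<close> by auto
  from steer[OF ne(1), of "x0 - p"] obtain z u where z: "\<And>\<tau>. (z has_vector_derivative f (z \<tau>) + g (u \<tau>)) (at \<tau>)"
      "continuous_on UNIV u" "z T0 = x0 - p" "z T1 = 0"
    by (elim null_steerableE) (rule that)
  \<comment> \<open>The times are exchanged here: \<open>y\<close> vanishes at \<open>T0\<close> and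
    attains \<open>x1 - p\<close> at \<open>T1\<close>.\<close>
  from steer[OF ne(2), of "x1 - p"] obtain y w where y: "\<And>\<tau>. (y has_vector_derivative f (y \<tau>) + g (w \<tau>)) (at \<tau>)"
      "continuous_on UNIV w" "y T1 = x1 - p" "y T0 = 0"
    by (elim null_steerableE) (rule that)
  define x where "x \<tau> = p + z \<tau> + y \<tau>" for \<tau>
  define v where "v \<tau> = q + u \<tau> + w \<tau>" for \<tau>
  have deriv: "(x has_vector_derivative (f (x \<tau>) + g (v \<tau>) - b)) (at \<tau>)" for \<tau>
  proof -
    have "(x has_vector_derivative (0 + (f (z \<tau>) + g (u \<tau>)) + (f (y \<tau>) + g (w \<tau>)))) (at \<tau>)"
      unfolding x_def
      by (intro has_vector_derivative_add has_vector_derivative_const z(1) y(1))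
    moreover have "0 + (f (z \<tau>) + g (u \<tau>)) + (f (y \<tau>) + g (w \<tau>)) = f (x \<tau>) + g (v \<tau>) - b"
      by (simp add: x_def v_def b linear_add[OF f] linear_add[OF g])
    ultimately show ?thesis by simp
  qed
  have v: "continuous_on UNIV v"
    unfolding v_def by (intro continuous_intros z(2) y(2))
  have "continuous_on UNIV x"
    by (meson continuous_at_imp_continuous_on deriv has_vector_derivative_continuous)
  then have "continuous_on UNIV (\<lambda>\<tau>. f (x \<tau>) + g (v \<tau>) - b)"
    by (intro continuous_on_diff continuous_on_add continuous_on_const
        linear_continuous_on_compose[OF _ f] linear_continuous_on_compose[OF _ g] v)
  then have "continuous_on {T0..T1} (\<lambda>\<tau>. f (x \<tau>) + g (v \<tau>) - b)"
    by (rule continuous_on_subset) simp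
  then have "abs_continuous_on_interval T0 T1 x"
    by (rule C1_imp_abs_continuous_on_interval[OF has_vector_derivative_at_within[OF deriv]])
  moreover have "f (x \<tau>) + g (v \<tau>) - b = - (A *v x \<tau>) + B *v v \<tau> - b" for \<tau>
    by (simp add: f_def g_def matrix_vector_mult_uminus_left)
  ultimately have "is_trajectory A B b T0 T1 v x0 x"
    using deriv z y by (auto simp: is_trajectory_def x_def)
  moreover have "x T1 = x1" using z y by (simp add: x_def)
  ultimately show "\<exists>u\<in>L_infinity T0 T1. \<exists>x. is_trajectory A B b T0 T1 u x0 x \<and> x T1 = x1"
    using continuous_on_imp_L_infinity[OF v] by blast
qed

section \<open>Necessity of the span condition\<close>

text \<open>If the span is proper, some eigenvector \<open>w\<close> is a direction that no control
  can influence, so trajectories with a common start cannot end with different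
  \<open>w\<close>-components.\<close>

lemma controllable_imp_krylov_span:
  fixes A :: "real ^ 'n ^ 'n" and B :: "real ^ 'm ^ 'n"
  assumes sym: "transpose A = A" and psd: "pos_semidef A" and "T0 < T1"
    and contr: "controllable A B b T0 T1"
  shows "span {matrix_pow (- A) i *v (B *v y) | i y. i < CARD('n)} = (UNIV :: (real ^ 'n) set)"
    (is "span ?K = _")
proof (rule ccontr)
  assume "span ?K \<noteq> UNIV"
  from span_not_UNIV_orthogonal[OF this]
  obtain a where "a \<noteq> 0" and a: "\<forall>v \<in> span ?K. a \<bullet> v = 0"
    by (elim exE conjE)
  define f where "f = (*v) (- A)"
  define g where "g = (*v) B"
  have f: "linear f" and g: "linear g" by (simp_all add: f_def g_def)
  have adj: "f v \<bullet> w = v \<bullet> f w" for v w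
  proof -
    have "(A *v v) \<bullet> w = v \<bullet> (A *v w)"
      using dot_lmul_matrix[of v A w] vector_transpose_matrix[of v A] unfolding sym by metis
    then show ?thesis by (simp only: f_def matrix_vector_mult_uminus_left inner_minus_left inner_minus_right)
  qed
  \<comment> \<open>Taking all powers \<open>k\<close> makes \<open>W\<close> invariant under the
    self-adjoint \<open>f\<close>. The vector \<open>a\<close> is at first orthogonal only to the
    iterates below n; a dependence of length at most n extends this to all.\<close>
  define W where "W = {w. \<forall>k y. w \<bullet> (f ^^ k) (g y) = 0}"
  have "a \<in> W"
    unfolding W_def
  proof (intro CollectI allI)
    fix k y
    obtain d c where d: "d \<le> DIM(real ^ 'n)" and dep: "(f ^^ d) (g y) = (\<Sum>i<d. c i *\<^sub>R (f ^^ i) (g y))"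
      using krylov_dependence by blast
    have "(f ^^ k) (g y) \<in> {v. a \<bullet> v = 0}"
    proof (rule krylov_subset[OF f dep subspace_hyperplane])
      fix i assume "i < d"
      then have "i < CARD('n)" using d by simp
      moreover have "(f ^^ i) (g y) = matrix_pow (- A) i *v (B *v y)"
        by (simp add: f_def g_def matrix_pow_mult_vector)
      ultimately have "(f ^^ i) (g y) \<in> span ?K" by (intro span_base) blast
      then show "(f ^^ i) (g y) \<in> {v. a \<bullet> v = 0}"
        using a by simp
    qed
    then show "a \<bullet> (f ^^ k) (g y) = 0" by simp
  qed
  have W: "subspace W"
    by (rule subspaceI) (auto simp: W_def inner_add_left)
  have fW: "f w \<in> W" if "w \<in> W" for w
    unfolding W_def
  proof (intro CollectI allI)
    fix k y
    have "w \<bullet> (f ^^ Suc k) (g y) = 0" using that unfolding W_def by blast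
    then show "f w \<bullet> (f ^^ k) (g y) = 0" by (simp add: adj)
  qed
  obtain w \<mu> where w: "w \<in> W" "norm w = 1" and eig: "f w = \<mu> *\<^sub>R w"
    using self_adjoint_eigenvector[OF f adj W fW \<open>a \<in> W\<close> \<open>a \<noteq> 0\<close>] by blast
  have ww: "w \<bullet> w = 1" using w(2) by (simp add: dot_square_norm)
  have "\<mu> = w \<bullet> f w" by (simp add: eig ww)
  also have "\<dots> \<le> 0" using psd by (simp add: f_def pos_semidef_def matrix_vector_mult_uminus_left)
  finally have "\<mu> \<le> 0" .
  have wg: "w \<bullet> g y = 0" for y
  proof -
    have "w \<bullet> (f ^^ 0) (g y) = 0" using w(1) unfolding W_def by blast
    then show ?thesis by simp
  qed
  \<comment> \<open>Both trajectories start at 0; one ends at \<open>w\<close> and the other at 0,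
    so \<open>z\<close> would have to pass from 0 to \<open>w \<bullet> w = 1\<close>.\<close>
  obtain u x where x: "is_trajectory A B b T0 T1 u 0 x" "x T1 = w"
    using contr unfolding controllable_def by blast
  obtain v y where y: "is_trajectory A B b T0 T1 v 0 y" "y T1 = 0"
    using contr unfolding controllable_def by blast
  define z where "z t = w \<bullet> (x t - y t)" for t
  have "abs_continuous_on_interval T0 T1 (\<lambda>t. x t - y t)"
    using x y by (intro abs_continuous_on_interval_diff) (auto simp: is_trajectory_def)
  then have "abs_continuous_on_interval T0 T1 z"
  proof (rule abs_continuous_on_interval_dominated[where L = 1])
    fix s t
    have "z t - z s = w \<bullet> ((x t - y t) - (x s - y s))"
      by (simp only: z_def inner_diff_right)
    then show "norm (z t - z s) \<le> 1 * norm ((x t - y t) - (x s - y s))"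
      using Cauchy_Schwarz_ineq2[of w "(x t - y t) - (x s - y s)"] w(2) by (simp only: real_norm_def)
  qed
  \<comment> \<open>The derivative of \<open>z\<close> has no fixed sign, but that of its square is
    \<open>2 * \<mu> * (z t)\<^sup>2\<close>, which is never positive.\<close>
  then have ac: "abs_continuous_on_interval T0 T1 (\<lambda>t. (z t)\<^sup>2)"
    by (rule abs_continuous_on_interval_power2)
  have "AE t in lebesgue_on {T0<..<T1}. \<exists>D\<le>0. ((\<lambda>t. (z t)\<^sup>2) has_real_derivative D) (at t)"
  proof -
    have fg: "f p + g q - b = - (A *v p) + B *v q - b" for p q
      by (simp add: f_def g_def matrix_vector_mult_uminus_left)
    have "AE t in lebesgue_on {T0<..<T1}. (x has_vector_derivative f (x t) + g (u t) - b) (at t)"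
      "AE t in lebesgue_on {T0<..<T1}. (y has_vector_derivative f (y t) + g (v t) - b) (at t)"
      using x(1) y(1) unfolding is_trajectory_def fg by blast+
    then show ?thesis
    proof eventually_elim
      case (elim t)
      \<comment> \<open>In the difference \<open>b\<close> cancels, and \<open>w\<close> annihilates
        the control terms. Self-adjointness moves \<open>f\<close> onto \<open>w\<close>, where it
        acts as \<open>\<mu>\<close>.\<close>
      let ?D = "(f (x t) + g (u t) - b) - (f (y t) + g (v t) - b)"
      have "(z has_vector_derivative w \<bullet> ?D) (at t)"
        unfolding z_def
        by (rule bounded_linear.has_vector_derivative[OF bounded_linear_inner_right
              has_vector_derivative_diff[OF elim]])
      moreover have "w \<bullet> ?D = \<mu> * z t"
      proof -
        have "w \<bullet> ?D = w \<bullet> f (x t - y t)"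
          by (simp add: linear_diff[OF f] inner_diff_right inner_add_right wg)
        also have "\<dots> = \<mu> * z t"
          using adj[of w "x t - y t"] by (simp only: eig inner_scaleR_left z_def)
        finally show ?thesis .
      qed
      ultimately have "(z has_real_derivative \<mu> * z t) (at t)"
        by (simp add: has_real_derivative_iff_has_vector_derivative)
      then have "((\<lambda>t. (z t)\<^sup>2) has_real_derivative 2 * \<mu> * (z t)\<^sup>2) (at t)"
        using DERIV_power[of z "\<mu> * z t" t UNIV 2] by (simp add: power2_eq_square mult_ac)
      moreover have "2 * \<mu> * (z t)\<^sup>2 \<le> 0"
        using \<open>\<mu> \<le> 0\<close> by (simp add: mult_nonpos_nonneg)
      ultimately show ?case by blast
    qed
  qed
  from abs_continuous_deriv_nonpos_imp_le[OF less_imp_le[OF \<open>T0 < T1\<close>] ac this]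
  have "(z T1)\<^sup>2 \<le> (z T0)\<^sup>2" .
  moreover have "z T0 = 0" "z T1 = 1"
    using x y ww unfolding z_def is_trajectory_def by simp_all
  ultimately show False by simp
qed

theorem theorem2:
  fixes A :: "real ^ 'n ^ 'n" and B :: "real ^ 'm ^ 'n" and b :: "real ^ 'n"
    and T0 T1 :: real
  assumes "CARD('m) \<le> CARD('n)"
    and "transpose A = A"
    and "pos_semidef A"
    and "T0 < T1"
  shows "controllable A B b T0 T1 \<longleftrightarrow>
    span {matrix_pow (- A) i *v (B *v y) | i y. i < CARD('n)} = (UNIV :: (real ^ 'n) set)"
  using controllable_imp_krylov_span[OF assms(2-4)] krylov_span_imp_controllable[OF assms(4)]
  by (rule iffI)

end
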